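(* Consider a step set $X\subseteq\mathbb{Z}^2\setminus\{O\}$. (i) If $X=\{A\}$, then $\mathcal{A}_X\cong(\mathbb{N},+)$. (ii) If $X=\{A,B\}$ where $A\neq B$ and $\angle AOB=0$, then $\mathcal{A}_X$ is isomorphic to a 2-generated submonoid of $(\mathbb{N},+)$. (iii) If $X=\{A,B\}$ where $\angle AOB=\pi$, then $\mathcal{A}_X\cong(\mathbb{Z},+)$. (iv) If $X=\{A,B\}$ where $0<\angle AOB<\pi$, then $\mathcal{A}_X\cong(\mathbb{N}\times\mathbb{N},+)$.
   Context: Write $O=(0,0)$ and $\mathbb{N}=\{0,1,2,\ldots\}$. A step set is any subset $X$ of $\mathbb{Z}^2\setminus\{O\}$, and $\mathcal{A}_X$ is the additive submonoid of $\mathbb{Z}^2$ generated by $X$ (with identity $O$). $\angle AOB\in[0,\pi]$ denotes the non-reflex angle between the segments $OA$ and $OB$. A submonoid of $\mathbb{N}$ is 2-generated if it is generated (as a monoid) by two elements. Isomorphisms are isomorphisms of monoids. *)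

theory Defs
  imports "HOL-Analysis.Linear_Algebra" "HOL-Algebra.Elementary_Groups"
begin

text \<open>
  Isomorphism of monoids is \<open>\<cong>\<close> from HOL-Algebra. It does not mention the
  identity elements, but a surjective multiplicative map between monoids preserves them.
\<close>

definition nat_monoid :: "nat monoid"
  where "nat_monoid = \<lparr>carrier = UNIV, monoid.mult = (+), one = 0\<rparr>"

definition int_plane :: "(int \<times> int) monoid"
  where "int_plane = integer_group \<times>\<times> integer_group"

text \<open>
  The least submonoid of \<open>G\<close> containing \<open>X\<close>, intended for \<open>X \<subseteq> carrier G\<close>. This is automatic for
  \<open>int_plane\<close> and \<open>nat_monoid\<close>, whose carriers are the full types.
\<close>
definition generated_submonoid :: "('a, 'b) monoid_scheme \<Rightarrow> 'a set \<Rightarrow> 'a set"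
  where "generated_submonoid G X = (\<lambda>H. submonoid H G) hull X"

definition step_monoid :: "(int \<times> int) set \<Rightarrow> (int \<times> int) monoid"
  where "step_monoid X = int_plane\<lparr>carrier := generated_submonoid int_plane X\<rparr>"

definition two_generated :: "nat set \<Rightarrow> bool"
  where "two_generated H \<longleftrightarrow> (\<exists>a b. a \<noteq> b \<and> H = generated_submonoid nat_monoid {a, b})"

definition real_point :: "int \<times> int \<Rightarrow> real \<times> real"
  where "real_point A = (real_of_int (fst A), real_of_int (snd A))"

text \<open>
  The non-reflex angle AOB, in \<open>[0, pi]\<close>. Only meaningful when \<open>A\<close> and \<open>B\<close>
  both differ from the origin, as elements of a step set do.
\<close>
definition angle_at_origin :: "int \<times> int \<Rightarrow> int \<times> int \<Rightarrow> real"
  where "angle_at_origin A B =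
    arccos (real_point A \<bullet> real_point B / (norm (real_point A) * norm (real_point B)))"

end

theory Submission
  imports Defs
begin

text \<open>
  Write \<open>A \<cdot> B\<close> and \<open>det A B\<close> for the integer dot product and determinant. By Lagrange's identity
  \<open>(A \<cdot> B)\<^sup>2 + (det A B)\<^sup>2 = (A \<cdot> A) (B \<cdot> B)\<close>, the angle is strictly between \<open>0\<close> and \<open>\<pi>\<close> iff
  \<open>det A B \<noteq> 0\<close>, and then \<open>(m, n) \<mapsto> m A + n B\<close> is injective. In the parallel case the functional
  \<open>P \<mapsto> A \<cdot> P\<close> is injective on the line \<open>OA\<close>, and so embeds the monoid into the integers. For angle
  \<open>0\<close> both generators have positive image. For angle \<open>\<pi>\<close> the images have opposite signs, so by
  Bezout they generate, as a monoid, all the multiples of their gcd.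
\<close>

section \<open>Integer dot product and determinant, and their relation to the angle\<close>

definition int_dot :: "int \<times> int \<Rightarrow> int \<times> int \<Rightarrow> int"
  where "int_dot A B = fst A * fst B + snd A * snd B"

definition int_det :: "int \<times> int \<Rightarrow> int \<times> int \<Rightarrow> int"
  where "int_det A B = fst A * snd B - snd A * fst B"

lemma lagrange_identity: "(int_dot A B)\<^sup>2 + (int_det A B)\<^sup>2 = int_dot A A * int_dot B B"
  by (simp add: int_dot_def int_det_def power2_eq_square algebra_simps)

lemma int_det_self: "int_det A A = 0"
  by (simp add: int_det_def)

lemma int_dot_self_eq_0_iff: "int_dot A A = 0 \<longleftrightarrow> A = (0, 0)"
  by (cases A) (simp add: int_dot_def)

lemma int_dot_self_pos_iff: "0 < int_dot A A \<longleftrightarrow> A \<noteq> (0, 0)"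
  using int_dot_self_eq_0_iff[of A] by (auto simp: int_dot_def order_less_le)

text \<open>If both the dot product and the determinant of \<open>A\<close> with
  \<open>P - Q\<close> vanish, Lagrange's identity leaves \<open>int_dot A A\<close> or the squared
  length of \<open>P - Q\<close> equal to zero, and \<open>A\<close> is not the origin.\<close>

lemma int_dot_inj_on_line:
  assumes "A \<noteq> (0, 0)"
  shows "inj_on (int_dot A) {P. int_det A P = 0}"
proof (rule inj_onI)
  fix P Q assume "P \<in> {P. int_det A P = 0}" "Q \<in> {P. int_det A P = 0}" "int_dot A P = int_dot A Q"
  then have "int_dot A (P - Q) = 0" "int_det A (P - Q) = 0"
    by (simp_all add: int_dot_def int_det_def algebra_simps)
  then have "P - Q = (0, 0)"
    using lagrange_identity[of A "P - Q"] assms int_dot_self_eq_0_iff by auto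
  then show "P = Q" by (simp add: prod_eq_iff)
qed

lemma angle_at_origin_eq_arccos:
  "angle_at_origin A B = arccos (int_dot A B / sqrt (int_dot A A * int_dot B B))"
  by (simp add: angle_at_origin_def real_point_def int_dot_def inner_prod_def norm_prod_def
      real_sqrt_mult power2_eq_square)

text \<open>Dropping the determinant term from Lagrange's identity gives Cauchy-Schwarz, so the
  quotient lies in the interval from -1 to 1, where \<open>cos\<close> undoes
  \<open>arccos\<close>.\<close>

lemma cos_angle_at_origin:
  assumes "A \<noteq> (0, 0)" "B \<noteq> (0, 0)"
  shows "cos (angle_at_origin A B) = int_dot A B / sqrt (int_dot A A * int_dot B B)"
proof -
  have "0 < int_dot A A * int_dot B B"
    using assms by (simp add: int_dot_self_pos_iff)
  moreover have "(int_dot A B)\<^sup>2 \<le> int_dot A A * int_dot B B"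
    using lagrange_identity[of A B] by (smt (verit) zero_le_power2)
  then have "(real_of_int (int_dot A B))\<^sup>2 \<le> real_of_int (int_dot A A * int_dot B B)"
    by (simp only: of_int_power[symmetric] of_int_le_iff)
  then have "\<bar>real_of_int (int_dot A B)\<bar> \<le> sqrt (int_dot A A * int_dot B B)"
    by (simp add: real_le_rsqrt)
  ultimately have "\<bar>int_dot A B / sqrt (int_dot A A * int_dot B B)\<bar> \<le> 1"
    by (simp add: divide_le_eq_1 del: of_int_mult)
  then show ?thesis
    unfolding angle_at_origin_eq_arccos by (rule cos_arccos_abs)
qed

text \<open>This is what separates angle 0 from angle \<open>pi\<close>, since the determinant
  vanishes in both cases.\<close>

lemma sgn_cos_angle_at_origin:
  assumes "A \<noteq> (0, 0)" "B \<noteq> (0, 0)"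
  shows "sgn (cos (angle_at_origin A B)) = of_int (sgn (int_dot A B))"
proof -
  have "0 < int_dot A A * int_dot B B"
    using assms by (simp add: int_dot_self_pos_iff)
  then have "0 < sqrt (int_dot A A * int_dot B B)"
    by (simp del: of_int_mult)
  then show ?thesis
    using assms[folded int_dot_self_eq_0_iff]
    by (simp add: cos_angle_at_origin[OF assms] sgn_if zero_less_divide_iff
        divide_less_0_iff del: of_int_mult real_sqrt_gt_0_iff real_sqrt_lt_0_iff)
qed

text \<open>Lagrange's identity divided by the product of the squared lengths, compared with the
  Pythagorean identity for \<open>sin\<close> and \<open>cos\<close>.\<close>

lemma sin_angle_at_origin_squared:
  assumes "A \<noteq> (0, 0)" "B \<noteq> (0, 0)"
  shows "(sin (angle_at_origin A B))\<^sup>2 = (int_det A B)\<^sup>2 / (int_dot A A * int_dot B B)"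
proof -
  have pos: "0 < int_dot A A * int_dot B B"
    using assms by (simp add: int_dot_self_pos_iff)
  have "real_of_int ((int_dot A B)\<^sup>2 + (int_det A B)\<^sup>2) = real_of_int (int_dot A A * int_dot B B)"
    by (simp only: lagrange_identity)
  moreover have "(cos (angle_at_origin A B))\<^sup>2 = (int_dot A B)\<^sup>2 / (int_dot A A * int_dot B B)"
    using cos_angle_at_origin[OF assms] pos by (simp add: power_divide del: of_int_mult)
  ultimately show ?thesis
    using assms[folded int_dot_self_eq_0_iff] by (simp add: sin_squared_eq field_simps)
qed

lemma sin_angle_at_origin_eq_0_iff:
  assumes "A \<noteq> (0, 0)" "B \<noteq> (0, 0)"
  shows "sin (angle_at_origin A B) = 0 \<longleftrightarrow> int_det A B = 0"
  using sin_angle_at_origin_squared[OF assms] assms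
  by (auto simp: int_dot_self_eq_0_iff)

section \<open>Bezout combinations and generalities on monoids\<close>

lemma int_gcd_combination:
  fixes p q k :: int
  assumes "p > 0" "q > 0"
  obtains m n :: nat where "int m * p - int n * q = k * gcd p q"
proof -
  obtain u v where uv: "u * p + v * q = gcd p q"
    using bezout_int by blast
  \<comment> \<open>The scaled Bezout coefficients \<open>k * u\<close> and \<open>- k * v\<close>
    may be negative. Adding \<open>t * q\<close> to the first and \<open>t * p\<close> to the second
    leaves the difference unchanged, and this \<open>t\<close> makes both nonnegative because
    \<open>p\<close> and \<open>q\<close> are at least 1.\<close>
  define t where "t = \<bar>k * u\<bar> + \<bar>k * v\<bar>"
  have "0 \<le> t" "\<bar>k * u\<bar> \<le> t" "\<bar>k * v\<bar> \<le> t"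
    by (simp_all add: t_def)
  moreover have "t \<le> t * q" "t \<le> t * p"
    using \<open>0 \<le> t\<close> assms mult_left_mono[of 1 q t] mult_left_mono[of 1 p t] by auto
  ultimately have "k * u + t * q \<ge> 0" "t * p - k * v \<ge> 0"
    by linarith+
  then have "int (nat (k * u + t * q)) * p - int (nat (t * p - k * v)) * q = k * gcd p q"
    unfolding uv[symmetric] by (simp add: algebra_simps)
  then show thesis by (rule that)
qed

text \<open>Some isomorphisms below are built from coefficients to lattice points, while the theorem
  asks for the opposite direction.\<close>

lemma (in monoid) monoid_iso_sym:
  assumes "G \<cong> H"
  shows "H \<cong> G"
proof -
  obtain h where h: "h \<in> hom G H" "bij_betw h (carrier G) (carrier H)"
    using assms by (auto simp: is_iso_def iso_def)
  have "inv_into (carrier G) h (h x \<otimes>\<^bsub>H\<^esub> h y) = x \<otimes> y" if "x \<in> carrier G" "y \<in> carrier G" for x y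
    using that h by (metis bij_betw_inv_into_left hom_mult m_closed)
  then have "inv_into (carrier G) h \<in> hom H G"
    using bij_betw_inv_into_right[OF h(2)] bij_betwE[OF bij_betw_inv_into[OF h(2)]]
    by (intro homI) metis+
  then show ?thesis
    using bij_betw_inv_into[OF h(2)] by (auto simp: is_iso_def iso_def)
qed

text \<open>Commutativity lets the exponents of a product be collected, so the products of powers
  form a submonoid; any submonoid containing \<open>a\<close> and \<open>b\<close> contains these
  products.\<close>

lemma (in comm_monoid) generated_submonoid_pair:
  assumes "a \<in> carrier G" "b \<in> carrier G"
  shows "generated_submonoid G {a, b} = range (\<lambda>(m::nat, n::nat). a [^] m \<otimes> b [^] n)" (is "_ = ?S")
  unfolding generated_submonoid_def
proof (rule hull_unique)
  have mem: "a [^] m \<otimes> b [^] n \<in> ?S" for m n :: nat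
    using rangeI[of "\<lambda>(m::nat, n::nat). a [^] m \<otimes> b [^] n" "(m, n)"] by simp
  have "a = a [^] (1::nat) \<otimes> b [^] (0::nat)" "b = a [^] (0::nat) \<otimes> b [^] (1::nat)"
    using assms by auto
  then show "{a, b} \<subseteq> ?S" using mem by (metis empty_subsetI insert_subset)
  show "submonoid ?S G"
  proof
    show "?S \<subseteq> carrier G" using assms by auto
    have "\<one> = a [^] (0::nat) \<otimes> b [^] (0::nat)" by simp
    then show "\<one> \<in> ?S" using mem by metis
    fix x y assume "x \<in> ?S" "y \<in> ?S"
    then obtain m n m' n' :: nat where "x = a [^] m \<otimes> b [^] n" "y = a [^] m' \<otimes> b [^] n'" by auto
    then have "x \<otimes> y = a [^] (m + m') \<otimes> b [^] (n + n')"
      using assms by (simp add: nat_pow_mult[symmetric] m_ac)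
    then show "x \<otimes> y \<in> ?S" using mem by metis
  qed
  fix T assume T: "{a, b} \<subseteq> T" "submonoid T G"
  have "c [^] n \<in> T" if "c \<in> T" for c and n :: nat
    using that T(2) by (induction n) (auto simp: submonoid.one_closed submonoid.m_closed)
  then show "?S \<subseteq> T"
    using T by (auto intro!: submonoid.m_closed)
qed

section \<open>The monoids of naturals and of lattice points in coordinates\<close>

lemma nat_monoid_simps [simp]:
  "carrier nat_monoid = UNIV" "x \<otimes>\<^bsub>nat_monoid\<^esub> y = x + y" "\<one>\<^bsub>nat_monoid\<^esub> = 0"
  by (simp_all add: nat_monoid_def)

lemma int_plane_simps [simp]:
  "carrier int_plane = UNIV" "P \<otimes>\<^bsub>int_plane\<^esub> Q = P + Q" "\<one>\<^bsub>int_plane\<^esub> = (0, 0)"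
  by (simp_all add: int_plane_def mult_DirProd' prod_eq_iff)

lemma comm_monoid_nat_monoid: "comm_monoid nat_monoid"
  by unfold_locales auto

lemma comm_monoid_int_plane: "comm_monoid int_plane"
  by unfold_locales (auto simp: prod_eq_iff)

lemma nat_pow_nat_monoid: "a [^]\<^bsub>nat_monoid\<^esub> (n::nat) = n * a"
  by (induction n) auto

lemma nat_pow_int_plane: "A [^]\<^bsub>int_plane\<^esub> (n::nat) = (int n * fst A, int n * snd A)"
  by (induction n) (auto simp: prod_eq_iff algebra_simps)

lemma generated_submonoid_nat_pair:
  "generated_submonoid nat_monoid {a, b} = range (\<lambda>(m, n). m * a + n * b)"
  using comm_monoid.generated_submonoid_pair[OF comm_monoid_nat_monoid]
  by (simp add: nat_pow_nat_monoid)

text \<open>The two coefficients form a single argument, so that this map is itself the candidate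
  isomorphism from \<open>nat_monoid \<times>\<times> nat_monoid\<close>.\<close>

definition lattice_combination :: "int \<times> int \<Rightarrow> int \<times> int \<Rightarrow> nat \<times> nat \<Rightarrow> int \<times> int"
  where "lattice_combination A B =
    (\<lambda>(m, n). (int m * fst A + int n * fst B, int m * snd A + int n * snd B))"

lemma lattice_combination_add:
  "lattice_combination A B (p + q) = lattice_combination A B p + lattice_combination A B q"
  by (simp add: lattice_combination_def case_prod_beta algebra_simps)

lemma int_dot_lattice_combination:
  "int_dot C (lattice_combination A B (m, n)) = int m * int_dot C A + int n * int_dot C B"
  by (simp add: int_dot_def lattice_combination_def algebra_simps)

lemma int_det_lattice_combination:
  "int_det C (lattice_combination A B (m, n)) = int m * int_det C A + int n * int_det C B"
  by (simp add: int_det_def lattice_combination_def algebra_simps)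

lemma carrier_step_monoid_pair [simp]:
  "carrier (step_monoid {A, B}) = range (lattice_combination A B)"
  using comm_monoid.generated_submonoid_pair[OF comm_monoid_int_plane]
  by (simp add: step_monoid_def nat_pow_int_plane lattice_combination_def)

lemma mult_step_monoid [simp]: "P \<otimes>\<^bsub>step_monoid X\<^esub> Q = P + Q"
  by (simp add: step_monoid_def)

lemma int_dot_add: "int_dot A (P + Q) = int_dot A P + int_dot A Q"
  by (simp add: int_dot_def algebra_simps)

section \<open>The isomorphism types of the step monoids\<close>

lemma step_monoid_singleton_iso:
  assumes "A \<noteq> (0, 0)"
  shows "step_monoid {A} \<cong> nat_monoid"
proof -
  have "inj (\<lambda>n. lattice_combination A A (n, 0))"
    using assms by (cases A) (auto simp: inj_on_def lattice_combination_def)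
  \<comment> \<open>The singleton is read as the pair \<open>{A, A}\<close>, whose two coefficients
    merge into one.\<close>
  moreover have "lattice_combination A A (m, n) = lattice_combination A A (m + n, 0)" for m n
    by (simp add: lattice_combination_def algebra_simps)
  then have "range (lattice_combination A A) = range (\<lambda>n. lattice_combination A A (n, 0))"
    by (metis (no_types, lifting) image_cong image_eqI subset_antisym image_subsetI surj_pair UNIV_I)
  then have "carrier (step_monoid {A}) = range (\<lambda>n. lattice_combination A A (n, 0))"
    using carrier_step_monoid_pair[of A A] by simp
  ultimately have "(\<lambda>n. lattice_combination A A (n, 0)) \<in> iso nat_monoid (step_monoid {A})"
    by (auto simp: iso_iff hom_def lattice_combination_add[symmetric])
  then show ?thesis
    using monoid.monoid_iso_sym[OF comm_monoid.axioms(1)[OF comm_monoid_nat_monoid]] is_isoI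
    by fastforce
qed

text \<open>Cramer's rule: \<open>int_det A\<close> kills the \<open>A\<close> term and so
  determines the coefficient of \<open>B\<close>; \<open>int_det B\<close> determines that of
  \<open>A\<close>.\<close>

lemma step_monoid_nonparallel_iso:
  assumes "int_det A B \<noteq> 0"
  shows "step_monoid {A, B} \<cong> nat_monoid \<times>\<times> nat_monoid"
proof -
  have "inj (lattice_combination A B)"
  proof (rule injI)
    fix p q assume eq: "lattice_combination A B p = lattice_combination A B q"
    have "int_det B A \<noteq> 0"
      using assms by (auto simp: int_det_def mult.commute)
    then show "p = q"
      using assms arg_cong[OF eq, of "int_det A"] arg_cong[OF eq, of "int_det B"]
      by (cases p; cases q) (simp add: int_det_lattice_combination int_det_self)
  qed
  then have "lattice_combination A B \<in> iso (nat_monoid \<times>\<times> nat_monoid) (step_monoid {A, B})"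
    by (auto simp: iso_iff hom_def lattice_combination_add[symmetric])
  moreover have "monoid (nat_monoid \<times>\<times> nat_monoid)"
    using comm_monoid_nat_monoid by (intro DirProd_monoid) (auto dest: comm_monoid.axioms(1))
  ultimately show ?thesis
    by (auto intro: monoid.monoid_iso_sym is_isoI)
qed

lemma int_dot_inj_on_step_monoid:
  assumes "A \<noteq> (0, 0)" "int_det A B = 0"
  shows "inj_on (int_dot A) (range (lattice_combination A B))"
  using assms by (intro inj_on_subset[OF int_dot_inj_on_line[OF assms(1)]])
    (auto simp: int_det_lattice_combination int_det_self)

lemma step_monoid_codirectional_iso:
  assumes "A \<noteq> (0, 0)" "A \<noteq> B" "int_det A B = 0" "int_dot A B > 0"
  shows "\<exists>H. two_generated H \<and> step_monoid {A, B} \<cong> nat_monoid\<lparr>carrier := H\<rparr>"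
proof (intro exI conjI)
  let ?a = "nat (int_dot A A)" and ?b = "nat (int_dot A B)"
  let ?h = "\<lambda>P. nat (int_dot A P)"
  have pos: "int_dot A A > 0"
    using assms by (simp add: int_dot_self_pos_iff)
  have nonneg: "int_dot A P \<ge> 0" if "P \<in> range (lattice_combination A B)" for P
    using that pos assms by (auto simp: int_dot_lattice_combination)
  \<comment> \<open>\<open>two_generated\<close> demands distinct generators; \<open>A\<close> and
    \<open>B\<close> lie on one line through the origin, where the dot product with \<open>A\<close>
    tells them apart.\<close>
  have "A \<in> {P. int_det A P = 0}" "B \<in> {P. int_det A P = 0}"
    using assms by (auto simp: int_det_def)
  then have "int_dot A A \<noteq> int_dot A B"
    using inj_onD[OF int_dot_inj_on_line[OF assms(1)]] assms(2) by blast
  then have "?a \<noteq> ?b"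
    using pos assms by auto
  then show "two_generated (generated_submonoid nat_monoid {?a, ?b})"
    unfolding two_generated_def by blast
  have h_comb: "?h (lattice_combination A B (m, n)) = m * ?a + n * ?b" for m n
    using pos assms(4)
    by (simp add: int_dot_lattice_combination nat_add_distrib nat_mult_distrib)
  have image: "?h ` range (lattice_combination A B) = generated_submonoid nat_monoid {?a, ?b}"
    unfolding generated_submonoid_nat_pair image_image
    by (intro image_cong refl) (auto simp: h_comb)
  \<comment> \<open>Truncation by \<open>nat\<close> loses nothing, as all the dot products involved
    are nonnegative.\<close>
  have "inj_on ?h (range (lattice_combination A B))"
    using inj_onD[OF int_dot_inj_on_step_monoid[OF assms(1,3)]] nonneg
    by (intro inj_onI) (metis nat_0_le)
  moreover have "?h \<in> hom (step_monoid {A, B})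
      (nat_monoid\<lparr>carrier := generated_submonoid nat_monoid {?a, ?b}\<rparr>)"
    unfolding image[symmetric]
    by (intro homI) (use nonneg in \<open>auto simp: int_dot_add nat_add_distrib\<close>)
  ultimately show "step_monoid {A, B} \<cong>
      nat_monoid\<lparr>carrier := generated_submonoid nat_monoid {?a, ?b}\<rparr>"
    using image by (intro is_isoI[of ?h]) (simp add: iso_iff)
qed

lemma step_monoid_opposite_iso:
  assumes "A \<noteq> (0, 0)" "int_det A B = 0" "int_dot A B < 0"
  shows "step_monoid {A, B} \<cong> integer_group"
proof -
  \<comment> \<open>The sign makes both arguments positive, as \<open>int_gcd_combination\<close>
    requires. Dividing by \<open>g\<close> turns the image, all multiples of \<open>g\<close>, into
    all integers; every division is exact, so additivity and injectivity survive.\<close>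
  define g where "g = gcd (int_dot A A) (- int_dot A B)"
  let ?h = "\<lambda>P. int_dot A P div g"
  have pos: "int_dot A A > 0"
    using assms by (simp add: int_dot_self_pos_iff)
  then have "g > 0"
    by (simp add: g_def)
  have dvd: "g dvd int_dot A P" if "P \<in> range (lattice_combination A B)" for P
  proof -
    have "g dvd int_dot A A" "g dvd int_dot A B"
      by (simp_all add: g_def)
    then show ?thesis
      using that by (auto simp: int_dot_lattice_combination)
  qed
  have "inj_on ?h (range (lattice_combination A B))"
    using inj_onD[OF int_dot_inj_on_step_monoid[OF assms(1,2)]] dvd
    by (intro inj_onI) (metis dvd_mult_div_cancel)
  moreover have "?h \<in> hom (step_monoid {A, B}) integer_group"
    using dvd by (intro homI) (auto simp: int_dot_add div_plus_div_distrib_dvd_left)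
  moreover have "k \<in> ?h ` range (lattice_combination A B)" for k
  proof -
    obtain m n where "int m * int_dot A A - int n * (- int_dot A B) = k * g"
      using int_gcd_combination[OF pos, of "- int_dot A B" k] assms(3) unfolding g_def by auto
    then have "?h (lattice_combination A B (m, n)) = k"
      using \<open>g > 0\<close> by (simp add: int_dot_lattice_combination)
    then show ?thesis by blast
  qed
  ultimately have "?h \<in> iso (step_monoid {A, B}) integer_group"
    by (auto simp: iso_iff)
  then show ?thesis by (rule is_isoI)
qed

theorem proposition2p11:
  fixes X :: "(int \<times> int) set"
  assumes "(0, 0) \<notin> X"
  shows "(\<forall>A. X = {A} \<longrightarrow> step_monoid X \<cong> nat_monoid) \<and>
    (\<forall>A B. X = {A, B} \<and> A \<noteq> B \<and> angle_at_origin A B = 0 \<longrightarrow>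
      (\<exists>H. two_generated H \<and> step_monoid X \<cong> nat_monoid\<lparr>carrier := H\<rparr>)) \<and>
    (\<forall>A B. X = {A, B} \<and> angle_at_origin A B = pi \<longrightarrow> step_monoid X \<cong> integer_group) \<and>
    (\<forall>A B. X = {A, B} \<and> 0 < angle_at_origin A B \<and> angle_at_origin A B < pi \<longrightarrow>
      step_monoid X \<cong> nat_monoid \<times>\<times> nat_monoid)"
proof (intro conjI allI impI; (elim conjE)?)
  fix A assume "X = {A}"
  then show "step_monoid X \<cong> nat_monoid"
    using assms step_monoid_singleton_iso[of A] by auto
next
  fix A B assume X: "X = {A, B}" and "A \<noteq> B" and angle: "angle_at_origin A B = 0"
  have nz: "A \<noteq> (0, 0)" "B \<noteq> (0, 0)" using assms X by auto
  have "int_det A B = 0"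
    using sin_angle_at_origin_eq_0_iff[OF nz] angle by simp
  moreover have "int_dot A B > 0"
    using sgn_cos_angle_at_origin[OF nz] angle by (simp add: sgn_if split: if_splits)
  ultimately show "\<exists>H. two_generated H \<and> step_monoid X \<cong> nat_monoid\<lparr>carrier := H\<rparr>"
    unfolding X by (intro step_monoid_codirectional_iso nz \<open>A \<noteq> B\<close>)
next
  fix A B assume X: "X = {A, B}" and angle: "angle_at_origin A B = pi"
  have nz: "A \<noteq> (0, 0)" "B \<noteq> (0, 0)" using assms X by auto
  have "int_det A B = 0"
    using sin_angle_at_origin_eq_0_iff[OF nz] angle by simp
  moreover have "int_dot A B < 0"
    using sgn_cos_angle_at_origin[OF nz] angle by (simp add: sgn_if split: if_splits)
  ultimately show "step_monoid X \<cong> integer_group"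
    unfolding X by (intro step_monoid_opposite_iso nz)
next
  fix A B assume X: "X = {A, B}" and angle: "0 < angle_at_origin A B" "angle_at_origin A B < pi"
  have nz: "A \<noteq> (0, 0)" "B \<noteq> (0, 0)" using assms X by auto
  have "int_det A B \<noteq> 0"
    \<comment> \<open>The sine is positive strictly between 0 and \<open>pi\<close>, so the
      determinant cannot vanish.\<close>
    using sin_angle_at_origin_eq_0_iff[OF nz] sin_gt_zero[OF angle] by simp
  then show "step_monoid X \<cong> nat_monoid \<times>\<times> nat_monoid"
    unfolding X by (rule step_monoid_nonparallel_iso)
qed

end
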